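(* Let $\Omega\subset\mathbb{R}^n$ be a domain and $F:\partial\Omega\to\mathbb{R}$ a bounded function. For $\epsilon>0$ let $u_\epsilon:\overline\Omega\to\mathbb{R}$ be the solution of $$\begin{cases}\mathcal{G}[u_\epsilon](x)=0, & x\in\Omega,\\ u_\epsilon(x)=F(x), & x\in\partial\Omega,\end{cases}$$ where $$\mathcal{G}[u_\epsilon](x)=\min\bigg\{u_\epsilon(x)-\inf_{y\in\overline{B}_\epsilon(x)\cap\overline{\Omega}}u_\epsilon(y)-\epsilon,\ \ u_\epsilon(x)-\frac{1}{2}\bigg(\sup_{y\in\overline{B}_\epsilon(x)\cap\overline{\Omega}}u_\epsilon(y)+\inf_{y\in\overline{B}_\epsilon(x)\cap\overline{\Omega}}u_\epsilon(y)\bigg)\bigg\}.$$ Assume that there exists a function $u$ such that $u_\epsilon\to u$ uniformly in $\overline{\Omega}$ as $\epsilon\to0$. Then $u$ is a viscosity solution to $$\begin{cases}\min\left\{|\nabla u|-1,\,-\Delta_\infty^N u\right\}=0, & \text{in }\Omega,\\ u=F, & \text{on }\partial\Omega.\end{cases}$$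
   Context: $\overline{B}_\epsilon(x)$ is the closed Euclidean ball of radius $\epsilon$ centered at $x$. The functions $u_\epsilon$ are not assumed continuous. The normalized infinity Laplacian is $$\Delta_\infty^N \varphi(x):=\begin{cases}\left\langle D^2\varphi(x)\frac{\nabla \varphi(x)}{|\nabla \varphi(x)|},\frac{\nabla \varphi(x)}{|\nabla \varphi(x)|}\right\rangle, & \nabla \varphi(x)\neq0,\\ \lim_{y\to x}\frac{2(\varphi(y)-\varphi(x))}{|y-x|^2}, & \text{otherwise.}\end{cases}$$ A viscosity subsolution of $\min\{|\nabla u|-1,-\Delta_\infty^N u\}=0$ in $\Omega$ is an upper semicontinuous function $u:\Omega\to\mathbb{R}$ such that $\min\{|\nabla\varphi(\hat x)|-1,-\Delta_\infty^N\varphi(\hat x)\}\le 0$ whenever $\hat x\in\Omega$ and $\varphi\in C^2(\Omega)$ satisfy $u(\hat x)=\varphi(\hat x)$ and $u\le\varphi$ in a neighborhood of $\hat x$. (When $\nabla\varphi(\hat x)=0$ this inequality is regarded as satisfied, since $|\nabla\varphi(\hat x)|-1<0$.) A viscosity supersolution is a lower semicontinuous function $u:\Omega\to\mathbb{R}$ such that $\min\{|\nabla\phi(\hat x)|-1,-\Delta_\infty^N\phi(\hat x)\}\ge 0$ whenever $\hat x\in\Omega$ and $\phi\in C^2(\Omega)$ satisfy $u(\hat x)=\phi(\hat x)$ and $u\ge\phi$ in a neighborhood of $\hat x$ (in particular $|\nabla\phi(\hat x)|\ge1$). A viscosity solution is a function that is both a viscosity subsolution and a viscosity supersolution. The boundary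 condition $u=F$ on $\partial\Omega$ is understood pointwise. *)

theory Defs
  imports "HOL-Analysis.Analysis"
begin

section \<open>Gradient, Hessian and the class \<open>C\<^sup>2\<close>\<close>

definition gradient :: "('a::euclidean_space \<Rightarrow> real) \<Rightarrow> 'a \<Rightarrow> 'a" where
  "gradient \<phi> x = (THE g. GDERIV \<phi> x :> g)"

text \<open>\<open>hessian \<phi> x v\<close> is the vector \<open>D\<^sup>2\<phi>(x) v\<close>.\<close>

definition hessian :: "('a::euclidean_space \<Rightarrow> real) \<Rightarrow> 'a \<Rightarrow> 'a \<Rightarrow> 'a" where
  "hessian \<phi> x v = frechet_derivative (gradient \<phi>) (at x) v"

text \<open>Meant for open \<open>S\<close>. In finite dimension, continuity of \<open>x \<mapsto> D\<^sup>2\<phi>(x) v\<close> for every fixed \<open>v\<close>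
  is continuity of \<open>D\<^sup>2\<phi>\<close>.\<close>

definition C2_on :: "'a::euclidean_space set \<Rightarrow> ('a \<Rightarrow> real) \<Rightarrow> bool" where
  "C2_on S \<phi> \<longleftrightarrow>
     (\<forall>x\<in>S. \<phi> differentiable (at x) \<and> gradient \<phi> differentiable (at x)) \<and>
     (\<forall>v. continuous_on S (\<lambda>x. hessian \<phi> x v))"

lemma gradient_eq:
  assumes "GDERIV \<phi> x :> g"
  shows "gradient \<phi> x = g"
  unfolding gradient_def
proof (rule the_equality)
  fix g' assume "GDERIV \<phi> x :> g'"
  with assms have "(\<lambda>h. h \<bullet> g') = (\<lambda>h. h \<bullet> g)"
    unfolding gderiv_def by (rule has_derivative_unique[rotated])
  then have "\<forall>h. h \<bullet> g' = h \<bullet> g"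
    by (simp add: fun_eq_iff)
  then show "g' = g"
    by (simp only: vector_eq_ldot)
qed (rule assms)

lemma GDERIV_gradient:
  assumes "\<phi> differentiable (at x)"
  shows "GDERIV \<phi> x :> gradient \<phi> x"
proof -
  obtain D where D: "(\<phi> has_derivative D) (at x)"
    using assms unfolding differentiable_def by blast
  interpret D: linear D
    using D by (rule has_derivative_linear)
  have "D h = h \<bullet> (\<Sum>i\<in>Basis. D i *\<^sub>R i)" for h
  proof -
    have "D h = D (\<Sum>i\<in>Basis. (h \<bullet> i) *\<^sub>R i)"
      by (simp add: euclidean_representation)
    then show ?thesis
      by (simp add: D.sum D.scale inner_sum_right mult.commute)
  qed
  then have "D = (\<lambda>h. h \<bullet> (\<Sum>i\<in>Basis. D i *\<^sub>R i))" ..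
  with D have G: "GDERIV \<phi> x :> (\<Sum>i\<in>Basis. D i *\<^sub>R i)"
    unfolding gderiv_def by (simp only:)
  then show ?thesis
    unfolding gradient_eq[OF G] .
qed


section \<open>The normalized infinity Laplacian and viscosity solutions\<close>

text \<open>If the limit in the second case does not exist, the value is unspecified. This is harmless below:
  where the gradient vanishes, the minimum of \<open>|\<nabla>\<phi>| - 1 = -1\<close> and any real number is negative.\<close>

definition normalized_inf_laplacian :: "('a::euclidean_space \<Rightarrow> real) \<Rightarrow> 'a \<Rightarrow> real" where
  "normalized_inf_laplacian \<phi> x =
     (if gradient \<phi> x \<noteq> 0
      then hessian \<phi> x (gradient \<phi> x /\<^sub>R norm (gradient \<phi> x)) \<bullet> (gradient \<phi> x /\<^sub>R norm (gradient \<phi> x))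
      else Lim (at x) (\<lambda>y. 2 * (\<phi> y - \<phi> x) / (norm (y - x))\<^sup>2))"

definition upper_semicontinuous_on :: "'a::topological_space set \<Rightarrow> ('a \<Rightarrow> real) \<Rightarrow> bool" where
  "upper_semicontinuous_on S u \<longleftrightarrow> (\<forall>x\<in>S. \<forall>c. u x < c \<longrightarrow> (\<forall>\<^sub>F y in at x within S. u y < c))"

definition lower_semicontinuous_on :: "'a::topological_space set \<Rightarrow> ('a \<Rightarrow> real) \<Rightarrow> bool" where
  "lower_semicontinuous_on S u \<longleftrightarrow> (\<forall>x\<in>S. \<forall>c. c < u x \<longrightarrow> (\<forall>\<^sub>F y in at x within S. c < u y))"

text \<open>Sub- and supersolutions of \<open>min {|\<nabla>u| - 1, -\<Delta>\<^sub>\<infinity>\<^sup>N u} = 0\<close> in an open set \<open>\<Omega>\<close>; only the values of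
  \<open>u\<close> in \<open>\<Omega>\<close> matter.\<close>

definition viscosity_subsolution :: "'a::euclidean_space set \<Rightarrow> ('a \<Rightarrow> real) \<Rightarrow> bool" where
  "viscosity_subsolution \<Omega> u \<longleftrightarrow>
     upper_semicontinuous_on \<Omega> u \<and>
     (\<forall>x \<phi>. x \<in> \<Omega> \<longrightarrow> C2_on \<Omega> \<phi> \<longrightarrow> u x = \<phi> x \<longrightarrow> (\<forall>\<^sub>F y in nhds x. u y \<le> \<phi> y) \<longrightarrow>
        min (norm (gradient \<phi> x) - 1) (- normalized_inf_laplacian \<phi> x) \<le> 0)"

definition viscosity_supersolution :: "'a::euclidean_space set \<Rightarrow> ('a \<Rightarrow> real) \<Rightarrow> bool" where
  "viscosity_supersolution \<Omega> u \<longleftrightarrow>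
     lower_semicontinuous_on \<Omega> u \<and>
     (\<forall>x \<phi>. x \<in> \<Omega> \<longrightarrow> C2_on \<Omega> \<phi> \<longrightarrow> u x = \<phi> x \<longrightarrow> (\<forall>\<^sub>F y in nhds x. u y \<ge> \<phi> y) \<longrightarrow>
        min (norm (gradient \<phi> x) - 1) (- normalized_inf_laplacian \<phi> x) \<ge> 0)"

definition viscosity_solution :: "'a::euclidean_space set \<Rightarrow> ('a \<Rightarrow> real) \<Rightarrow> bool" where
  "viscosity_solution \<Omega> u \<longleftrightarrow> viscosity_subsolution \<Omega> u \<and> viscosity_supersolution \<Omega> u"


section \<open>The operator \<open>\<G>\<close>\<close>

text \<open>Supremum and infimum are taken in the extended reals, as \<open>u\<close> is not assumed bounded. By
  \<open>dpp_operator_eq_0_iff\<close> below, the equation \<open>\<G>[u](x) = 0\<close> forces both to be finite, so the convention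
  \<open>\<infinity> + (-\<infinity>) = \<infinity>\<close> of type \<open>ereal\<close> plays no role.\<close>

definition dpp_operator :: "'a::euclidean_space set \<Rightarrow> real \<Rightarrow> ('a \<Rightarrow> real) \<Rightarrow> 'a \<Rightarrow> ereal" where
  "dpp_operator \<Omega> \<epsilon> u x =
     min (ereal (u x) - (INF y\<in>cball x \<epsilon> \<inter> closure \<Omega>. ereal (u y)) - ereal \<epsilon>)
         (ereal (u x) - ereal (1 / 2) *
            ((SUP y\<in>cball x \<epsilon> \<inter> closure \<Omega>. ereal (u y)) + (INF y\<in>cball x \<epsilon> \<inter> closure \<Omega>. ereal (u y))))"

lemma dpp_operator_eq_0_iff:
  assumes "x \<in> closure \<Omega>" "\<epsilon> > 0"
  defines "B \<equiv> cball x \<epsilon> \<inter> closure \<Omega>"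
  shows "dpp_operator \<Omega> \<epsilon> u x = 0 \<longleftrightarrow>
           bdd_above (u ` B) \<and> bdd_below (u ` B) \<and>
           min (u x - (INF y\<in>B. u y) - \<epsilon>) (u x - 1 / 2 * ((SUP y\<in>B. u y) + (INF y\<in>B. u y))) = 0"
proof -
  define S I where "S = (SUP y\<in>B. ereal (u y))" and "I = (INF y\<in>B. ereal (u y))"
  have xB: "x \<in> B"
    using assms by (simp add: B_def)
  have "ereal (u x) \<le> S" "I \<le> ereal (u x)"
    unfolding S_def I_def using xB by (auto intro: SUP_upper INF_lower)
  then have S: "S \<noteq> -\<infinity>" and I: "I \<noteq> \<infinity>"
    by auto
  have op: "dpp_operator \<Omega> \<epsilon> u x = min (ereal (u x) - I - ereal \<epsilon>) (ereal (u x) - ereal (1/2) * (S + I))"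
    by (simp add: dpp_operator_def S_def I_def B_def)
  have "dpp_operator \<Omega> \<epsilon> u x \<noteq> 0" if "S = \<infinity> \<or> I = -\<infinity>"
    using that S I unfolding op by (cases S; cases I) (auto simp: min_def)
  moreover have "S = \<infinity> \<or> bdd_above (u ` B)"
  proof (cases S)
    case (real s)
    have "u y \<le> s" if "y \<in> B" for y
      using SUP_upper[OF that, of "\<lambda>y. ereal (u y)"] real by (simp add: S_def)
    then show ?thesis
      by (auto simp: bdd_above_def)
  qed (use S in auto)
  moreover have "I = -\<infinity> \<or> bdd_below (u ` B)"
  proof (cases I)
    case (real s)
    have "s \<le> u y" if "y \<in> B" for y
      using INF_lower[OF that, of "\<lambda>y. ereal (u y)"] real by (simp add: I_def)
    then show ?thesis
      by (auto simp: bdd_below_def)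
  qed (use I in auto)
  moreover have "dpp_operator \<Omega> \<epsilon> u x =
      ereal (min (u x - (INF y\<in>B. u y) - \<epsilon>) (u x - 1 / 2 * ((SUP y\<in>B. u y) + (INF y\<in>B. u y))))"
    if ab: "bdd_above (u ` B)" "bdd_below (u ` B)"
  proof -
    have fin: "\<bar>S\<bar> \<noteq> \<infinity>" "\<bar>I\<bar> \<noteq> \<infinity>"
    proof -
      obtain s i where "\<And>y. y \<in> B \<Longrightarrow> u y \<le> s" "\<And>y. y \<in> B \<Longrightarrow> i \<le> u y"
        using ab by (auto simp: bdd_above_def bdd_below_def)
      then have "S \<le> ereal s" "ereal i \<le> I"
        unfolding S_def I_def by (auto intro!: SUP_least INF_greatest)
      then show "\<bar>S\<bar> \<noteq> \<infinity>" "\<bar>I\<bar> \<noteq> \<infinity>"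
        using S I by auto
    qed
    have "S = ereal (SUP y\<in>B. u y)" "I = ereal (INF y\<in>B. u y)"
      using ereal_SUP[of u B] ereal_INF[of u B] fin by (simp_all add: S_def I_def)
    then show ?thesis
      unfolding op by (simp add: min_def)
  qed
  ultimately show ?thesis
    by (metis ereal_eq_0(1))
qed

definition dpp_solution ::
    "'a::euclidean_space set \<Rightarrow> ('a \<Rightarrow> real) \<Rightarrow> real \<Rightarrow> ('a \<Rightarrow> real) \<Rightarrow> bool" where
  "dpp_solution \<Omega> F \<epsilon> u \<longleftrightarrow>
     (\<forall>x\<in>\<Omega>. dpp_operator \<Omega> \<epsilon> u x = 0) \<and> (\<forall>x\<in>frontier \<Omega>. u x = F x)"

end

theory Submission
  imports Defs
begin

text \<open>Put \<open>S\<^sup>-(x) = u\<^sub>\<epsilon>(x) - inf u\<^sub>\<epsilon>\<close> and \<open>S\<^sup>+(x) = sup u\<^sub>\<epsilon> - u\<^sub>\<epsilon>(x)\<close> over the \<open>\<epsilon>\<close>-ball of \<open>x\<close>; the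
  equation says \<open>S\<^sup>- = max(\<epsilon>, S\<^sup>+)\<close>. Because \<open>S\<^sup>+ \<le> S\<^sup>-\<close>, a large increment at \<open>x\<close> forces \<open>u\<^sub>\<epsilon>\<close> to decrease
  by as much in each of many consecutive steps, so local boundedness gives increments \<open>O(\<epsilon>)\<close> and the
  limit \<open>u\<close> is locally Lipschitz.

  If \<open>u\<close> is touched from above at \<open>x\<close> by \<open>\<psi>\<close>, replace \<open>\<psi>\<close> by \<open>\<phi> = \<psi> + |\<cdot> - x|\<^sup>4\<close> and choose points
  \<open>x\<^sub>\<epsilon> \<rightarrow> x\<close> where \<open>u\<^sub>\<epsilon> - \<phi>\<close> is maximal up to \<open>\<epsilon>\<^sup>3\<close>. This transfers the equation to \<open>\<phi>\<close> with error \<open>\<epsilon>\<^sup>3\<close>.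
  First differences of \<open>\<phi>\<close> divided by \<open>\<epsilon>\<close> give the gradient; a maximum point of \<open>\<phi>\<close> on the \<open>\<epsilon>\<close>-ball lies
  asymptotically in gradient direction, so the second difference through it and its antipode, divided by
  \<open>\<epsilon>\<^sup>2\<close>, gives the normalized infinity Laplacian. Touching from below is reduced to this case by
  changing signs.\<close>

section \<open>Finite differences of twice differentiable functions\<close>

text \<open>Gradient and second derivative are explicit data, so that negating \<open>\<phi>\<close>
  or adding a polynomial changes them by formulas. Continuity of \<open>H\<close> is asked for at
  \<open>x\<close> alone, where all limits are taken.\<close>

definition C2_near :: "'a::euclidean_space \<Rightarrow> ('a \<Rightarrow> real) \<Rightarrow> ('a \<Rightarrow> 'a) \<Rightarrow> ('a \<Rightarrow> 'a \<Rightarrow> 'a) \<Rightarrow> bool" where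
  "C2_near x \<phi> g H \<longleftrightarrow>
     (\<forall>\<^sub>F y in nhds x. GDERIV \<phi> y :> g y \<and> (g has_derivative H y) (at y)) \<and>
     (\<forall>v. isCont (\<lambda>y. H y v) x)"

lemma C2_near_uminus:
  assumes "C2_near x \<phi> g H"
  shows "C2_near x (\<lambda>y. - \<phi> y) (\<lambda>y. - g y) (\<lambda>y v. - H y v)"
proof -
  have *: "GDERIV (\<lambda>y. - \<phi> y) y :> - g y" if "GDERIV \<phi> y :> g y" for y
    using that has_derivative_minus unfolding gderiv_def by fastforce
  show ?thesis
    using assms unfolding C2_near_def
    by (auto elim!: eventually_mono intro!: * has_derivative_minus continuous_intros)
qed

text \<open>The fourth power makes a touching point a strict one, and its first and second
  derivatives vanish at \<open>x\<close>, so \<open>g x\<close> and \<open>H x\<close> stay the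
  same.\<close>

lemma C2_near_add_quartic:
  assumes "C2_near x \<phi> g H"
  shows "C2_near x (\<lambda>y. \<phi> y + (norm (y - x)) ^ 4)
           (\<lambda>y. g y + (4 * (norm (y - x))\<^sup>2) *\<^sub>R (y - x))
           (\<lambda>y v. H y v + ((8 * ((y - x) \<bullet> v)) *\<^sub>R (y - x) + (4 * (norm (y - x))\<^sup>2) *\<^sub>R v))"
proof -
  have n4: "(norm z) ^ 4 = (z \<bullet> z)\<^sup>2" for z :: 'a
    by (simp add: dot_square_norm flip: power_mult)
  have 1: "GDERIV (\<lambda>y. \<phi> y + (norm (y - x)) ^ 4) y :> g y + (4 * (norm (y - x))\<^sup>2) *\<^sub>R (y - x)"
    if "GDERIV \<phi> y :> g y" for y
    using that unfolding gderiv_def n4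
    by (auto intro!: derivative_eq_intros
      simp: fun_eq_iff algebra_simps inner_commute dot_square_norm[symmetric])
  have 2: "((\<lambda>y. g y + (4 * (norm (y - x))\<^sup>2) *\<^sub>R (y - x)) has_derivative
     (\<lambda>v. H y v + ((8 * ((y - x) \<bullet> v)) *\<^sub>R (y - x) + (4 * (norm (y - x))\<^sup>2) *\<^sub>R v))) (at y)"
    if "(g has_derivative H y) (at y)" for y
    using that unfolding dot_square_norm[symmetric]
    by (auto intro!: derivative_eq_intros
      simp: fun_eq_iff algebra_simps inner_commute)
  show ?thesis
    using assms unfolding C2_near_def
    by (auto elim!: eventually_mono intro!: 1 2 continuous_intros)
qed

lemma C2_near_of_C2_on:
  assumes "open S" "x \<in> S" "C2_on S \<phi>"
  shows "C2_near x \<phi> (gradient \<phi>) (hessian \<phi>)"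
proof -
  have "\<forall>\<^sub>F y in nhds x. y \<in> S"
    using assms eventually_nhds_in_open by blast
  then have "\<forall>\<^sub>F y in nhds x. GDERIV \<phi> y :> gradient \<phi> y \<and> (gradient \<phi> has_derivative hessian \<phi> y) (at y)"
  proof (rule eventually_mono)
    fix y assume "y \<in> S"
    then have "\<phi> differentiable (at y)" "gradient \<phi> differentiable (at y)"
      using assms unfolding C2_on_def by auto
    moreover have "hessian \<phi> y = frechet_derivative (gradient \<phi>) (at y)"
      by (simp add: hessian_def fun_eq_iff)
    ultimately show "GDERIV \<phi> y :> gradient \<phi> y \<and> (gradient \<phi> has_derivative hessian \<phi> y) (at y)"
      by (simp add: GDERIV_gradient frechet_derivative_works flip: hessian_def)
  qed
  moreover have "isCont (\<lambda>y. hessian \<phi> y v) x" for v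
    using assms by (auto simp: C2_on_def continuous_on_eq_continuous_at)
  ultimately show ?thesis
    by (simp add: C2_near_def)
qed

lemma C2_near_ball:
  assumes "C2_near x \<phi> g H"
  obtains r where "r > 0" "\<And>y. y \<in> ball x r \<Longrightarrow> GDERIV \<phi> y :> g y"
    "\<And>y. y \<in> ball x r \<Longrightarrow> (g has_derivative H y) (at y)"
  using assms unfolding C2_near_def eventually_nhds_metric by (auto simp: dist_commute)

lemma tendsto_perturb:
  fixes X :: "nat \<Rightarrow> 'a::real_normed_vector"
  assumes "X \<longlonglongrightarrow> x" "\<epsilon> \<longlonglongrightarrow> 0" "\<forall>\<^sub>F k in sequentially. dist (\<xi> k) (X k) \<le> \<epsilon> k"
  shows "\<xi> \<longlonglongrightarrow> x"
proof -
  have "(\<lambda>k. \<xi> k - X k) \<longlonglongrightarrow> 0"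
    by (rule Lim_null_comparison[OF _ assms(2)]) (use assms(3) in \<open>simp add: dist_norm\<close>)
  from tendsto_add[OF this assms(1)] show ?thesis
    by simp
qed

lemma eventually_cball_subset_ball:
  fixes X :: "nat \<Rightarrow> 'a::metric_space"
  assumes "X \<longlonglongrightarrow> x" "\<epsilon> \<longlonglongrightarrow> (0::real)" "r > 0"
  shows "\<forall>\<^sub>F k in sequentially. cball (X k) (\<epsilon> k) \<subseteq> ball x r"
proof -
  have "\<forall>\<^sub>F k in sequentially. dist (X k) x < r / 2" "\<forall>\<^sub>F k in sequentially. \<epsilon> k < r / 2"
    using tendstoD[OF assms(1), of "r/2"] order_tendstoD(2)[OF assms(2), of "r/2"] assms(3) by auto
  then show ?thesis
    by eventually_elim (auto, smt (verit) dist_commute dist_triangle)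
qed

section \<open>Difference quotients along segments of shrinking length\<close>

lemma line_has_real_derivative:
  assumes "GDERIV \<phi> (x + t *\<^sub>R v) :> g"
  shows "((\<lambda>t. \<phi> (x + t *\<^sub>R v)) has_real_derivative (v \<bullet> g)) (at t)"
proof -
  have "((\<lambda>t. x + t *\<^sub>R v) has_derivative (\<lambda>h. h *\<^sub>R v)) (at t)"
    by (auto intro!: derivative_eq_intros)
  from has_derivative_compose[OF this assms[unfolded gderiv_def]] show ?thesis
    by (simp add: has_field_derivative_def mult_commute_abs)
qed

lemma line_inner_has_real_derivative:
  assumes "(g has_derivative D) (at (x + t *\<^sub>R v))"
  shows "((\<lambda>t. v \<bullet> g (x + t *\<^sub>R v)) has_real_derivative (v \<bullet> D v)) (at t)"
proof -
  have "((\<lambda>t. x + t *\<^sub>R v) has_derivative (\<lambda>h. h *\<^sub>R v)) (at t)"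
    by (auto intro!: derivative_eq_intros)
  from has_derivative_inner_right[OF has_derivative_compose[OF this assms]] show ?thesis
    by (simp add: has_field_derivative_def linear_cmul[OF has_derivative_linear[OF assms]] mult_commute_abs)
qed

lemma dist_scaleR_le:
  fixes v :: "'a::real_normed_vector"
  assumes "norm v \<le> 1" "\<bar>t\<bar> \<le> e"
  shows "dist (x + t *\<^sub>R v) x \<le> e"
  using mult_mono[OF assms(2,1)] assms(2) by (simp add: dist_norm)

text \<open>The mean value theorem yields an intermediate point tending to \<open>x\<close>, and
  \<open>g\<close> is continuous there. The directions \<open>V k\<close> are merely bounded, so the
  quotient is compared with \<open>V k \<bullet> g x\<close> instead of a fixed limit.\<close>

lemma first_difference_tendsto:
  assumes "C2_near x \<phi> g H" "X \<longlonglongrightarrow> x" "\<epsilon> \<longlonglongrightarrow> 0" "\<And>k. \<epsilon> k > 0" "\<And>k. norm (V k) \<le> 1"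
  shows "(\<lambda>k. (\<phi> (X k + \<epsilon> k *\<^sub>R V k) - \<phi> (X k)) / \<epsilon> k - V k \<bullet> g x) \<longlonglongrightarrow> 0"
proof -
  obtain r where r: "r > 0" "\<And>y. y \<in> ball x r \<Longrightarrow> GDERIV \<phi> y :> g y"
    "\<And>y. y \<in> ball x r \<Longrightarrow> (g has_derivative H y) (at y)"
    using C2_near_ball[OF assms(1)] by metis
  \<comment> \<open>The inclusion in the region of differentiability holds only for large
    \<open>k\<close>; as a premise inside the existential it allows a choice for every
    \<open>k\<close>.\<close>
  have "\<exists>\<xi>. cball (X k) (\<epsilon> k) \<subseteq> ball x r \<longrightarrow> dist \<xi> (X k) \<le> \<epsilon> k \<and>
          \<phi> (X k + \<epsilon> k *\<^sub>R V k) - \<phi> (X k) = \<epsilon> k * (V k \<bullet> g \<xi>)" for k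
  proof (cases "cball (X k) (\<epsilon> k) \<subseteq> ball x r")
    case True
    have d: "dist (X k + t *\<^sub>R V k) (X k) \<le> \<epsilon> k" if "\<bar>t\<bar> \<le> \<epsilon> k" for t
      by (rule dist_scaleR_le[OF assms(5) that])
    have in_ball: "X k + t *\<^sub>R V k \<in> ball x r" if "\<bar>t\<bar> \<le> \<epsilon> k" for t
      using True by (rule subsetD) (use d[OF that] in \<open>simp add: dist_commute\<close>)
    have D: "((\<lambda>t. \<phi> (X k + t *\<^sub>R V k)) has_real_derivative (V k \<bullet> g (X k + t *\<^sub>R V k))) (at t)"
      if "\<bar>t\<bar> \<le> \<epsilon> k" for t
      by (intro line_has_real_derivative r(2) in_ball that)
    obtain s where "0 < s" "s < \<epsilon> k" "\<phi> (X k + \<epsilon> k *\<^sub>R V k) - \<phi> (X k + 0 *\<^sub>R V k) =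
        (\<epsilon> k - 0) * (V k \<bullet> g (X k + s *\<^sub>R V k))"
      using MVT2[of 0 "\<epsilon> k" "\<lambda>t. \<phi> (X k + t *\<^sub>R V k)" "\<lambda>t. V k \<bullet> g (X k + t *\<^sub>R V k)"] D assms(4)[of k]
      by auto
    then show ?thesis
      using d[of s] by (intro exI[of _ "X k + s *\<^sub>R V k"]) auto
  qed auto
  then obtain \<xi> where \<xi>: "\<And>k. cball (X k) (\<epsilon> k) \<subseteq> ball x r \<Longrightarrow> dist (\<xi> k) (X k) \<le> \<epsilon> k \<and>
          \<phi> (X k + \<epsilon> k *\<^sub>R V k) - \<phi> (X k) = \<epsilon> k * (V k \<bullet> g (\<xi> k))"
    by metis
  note ev = eventually_cball_subset_ball[OF assms(2,3) r(1)]
  have "\<xi> \<longlonglongrightarrow> x"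
    by (rule tendsto_perturb[OF assms(2,3)]) (use ev \<xi> in \<open>auto elim: eventually_mono\<close>)
  moreover have "isCont g x"
    using r(1) r(3)[of x] has_derivative_continuous by auto
  ultimately have "(\<lambda>k. g (\<xi> k)) \<longlonglongrightarrow> g x"
    by (rule isCont_tendsto_compose[rotated])
  then have "(\<lambda>k. norm (g (\<xi> k) - g x)) \<longlonglongrightarrow> 0"
    using LIM_zero tendsto_norm_zero by blast
  moreover have "\<forall>\<^sub>F k in sequentially.
    norm ((\<phi> (X k + \<epsilon> k *\<^sub>R V k) - \<phi> (X k)) / \<epsilon> k - V k \<bullet> g x) \<le> norm (g (\<xi> k) - g x)"
    using ev
  proof eventually_elim
    case (elim k)
    have "(\<phi> (X k + \<epsilon> k *\<^sub>R V k) - \<phi> (X k)) / \<epsilon> k - V k \<bullet> g x = V k \<bullet> (g (\<xi> k) - g x)"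
      using \<xi>[OF elim] assms(4)[of k] by (simp add: inner_diff_right)
    moreover have "\<bar>V k \<bullet> (g (\<xi> k) - g x)\<bar> \<le> 1 * norm (g (\<xi> k) - g x)"
      using Cauchy_Schwarz_ineq2[of "V k" "g (\<xi> k) - g x"]
        mult_right_mono[OF assms(5)[of k] norm_ge_zero[of "g (\<xi> k) - g x"]] by linarith
    ultimately show ?case
      by simp
  qed
  ultimately show ?thesis
    by (rule Lim_null_comparison[rotated])
qed

text \<open>Taylor expansion to second order in the directions \<open>V k\<close> and
  \<open>- V k\<close>: the first-order terms cancel, and the mean of two second derivatives at
  nearby points remains.\<close>

lemma second_difference_tendsto:
  assumes "C2_near x \<phi> g H" "X \<longlonglongrightarrow> x" "\<epsilon> \<longlonglongrightarrow> 0" "\<And>k. \<epsilon> k > 0" "\<And>k. norm (V k) \<le> 1" "V \<longlonglongrightarrow> v"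
  shows "(\<lambda>k. (\<phi> (X k + \<epsilon> k *\<^sub>R V k) + \<phi> (X k - \<epsilon> k *\<^sub>R V k) - 2 * \<phi> (X k)) / (\<epsilon> k)\<^sup>2)
           \<longlonglongrightarrow> v \<bullet> H x v"
proof -
  obtain r where r: "r > 0" "\<And>y. y \<in> ball x r \<Longrightarrow> GDERIV \<phi> y :> g y"
    "\<And>y. y \<in> ball x r \<Longrightarrow> (g has_derivative H y) (at y)"
    using C2_near_ball[OF assms(1)] by metis
  have "\<exists>\<xi> \<eta>. cball (X k) (\<epsilon> k) \<subseteq> ball x r \<longrightarrow> dist \<xi> (X k) \<le> \<epsilon> k \<and> dist \<eta> (X k) \<le> \<epsilon> k \<and>
          \<phi> (X k + \<epsilon> k *\<^sub>R V k) + \<phi> (X k - \<epsilon> k *\<^sub>R V k) - 2 * \<phi> (X k) =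
            (\<epsilon> k)\<^sup>2 * ((V k \<bullet> H \<xi> (V k) + V k \<bullet> H \<eta> (V k)) / 2)" for k
  proof (cases "cball (X k) (\<epsilon> k) \<subseteq> ball x r")
    case True
    have d: "dist (X k + t *\<^sub>R V k) (X k) \<le> \<epsilon> k" if "\<bar>t\<bar> \<le> \<epsilon> k" for t
      by (rule dist_scaleR_le[OF assms(5) that])
    have in_ball: "X k + t *\<^sub>R V k \<in> ball x r" if "\<bar>t\<bar> \<le> \<epsilon> k" for t
      using True by (rule subsetD) (use d[OF that] in \<open>simp add: dist_commute\<close>)
    have D1: "((\<lambda>t. \<phi> (X k + t *\<^sub>R V k)) has_real_derivative (V k \<bullet> g (X k + t *\<^sub>R V k))) (at t)"
      if "\<bar>t\<bar> \<le> \<epsilon> k" for t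
      by (intro line_has_real_derivative r(2) in_ball that)
    have D2: "((\<lambda>t. V k \<bullet> g (X k + t *\<^sub>R V k)) has_real_derivative
        (V k \<bullet> H (X k + t *\<^sub>R V k) (V k))) (at t)" if "\<bar>t\<bar> \<le> \<epsilon> k" for t
      by (intro line_inner_has_real_derivative r(3) in_ball that)
    \<comment> \<open>The sequence of derivatives in the form Taylor's theorem expects. Indices from
      2 on all carry the second derivative, as the derivative relation is required for
      \<open>m < 2\<close> only.\<close>
    define diff where "diff m t = (if m = 0 then \<phi> (X k + t *\<^sub>R V k)
      else if m = 1 then V k \<bullet> g (X k + t *\<^sub>R V k) else V k \<bullet> H (X k + t *\<^sub>R V k) (V k))"
      for m :: nat and t
    have D: "\<forall>m t. m < 2 \<and> - \<epsilon> k \<le> t \<and> t \<le> \<epsilon> k \<longrightarrow> (diff m has_real_derivative diff (Suc m) t) (at t)"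
      using D1 D2 unfolding diff_def by (auto simp: less_2_cases_iff)
    have T: "\<exists>s. \<bar>s\<bar> \<le> \<epsilon> k \<and> diff 0 t = diff 0 0 + diff 1 0 * t + diff 2 s / 2 * t\<^sup>2"
      if "t = \<epsilon> k \<or> t = - \<epsilon> k" for t
      using Taylor[of 2 diff "diff 0" "- \<epsilon> k" "\<epsilon> k" 0 t] D that assms(4)[of k]
      by (force simp: numeral_2_eq_2)
    obtain s s' where "\<bar>s\<bar> \<le> \<epsilon> k" "diff 0 (\<epsilon> k) = diff 0 0 + diff 1 0 * \<epsilon> k + diff 2 s / 2 * (\<epsilon> k)\<^sup>2"
      "\<bar>s'\<bar> \<le> \<epsilon> k" "diff 0 (- \<epsilon> k) = diff 0 0 + diff 1 0 * - \<epsilon> k + diff 2 s' / 2 * (- \<epsilon> k)\<^sup>2"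
      using T by metis
    then show ?thesis
      using d[of s] d[of s']
      by (intro exI[of _ "X k + s *\<^sub>R V k"] exI[of _ "X k + s' *\<^sub>R V k"])
        (auto simp: diff_def field_simps)
  qed auto
  then obtain \<xi> \<eta> where \<xi>: "\<And>k. cball (X k) (\<epsilon> k) \<subseteq> ball x r \<Longrightarrow>
      dist (\<xi> k) (X k) \<le> \<epsilon> k \<and> dist (\<eta> k) (X k) \<le> \<epsilon> k \<and>
      \<phi> (X k + \<epsilon> k *\<^sub>R V k) + \<phi> (X k - \<epsilon> k *\<^sub>R V k) - 2 * \<phi> (X k) =
        (\<epsilon> k)\<^sup>2 * ((V k \<bullet> H (\<xi> k) (V k) + V k \<bullet> H (\<eta> k) (V k)) / 2)"
    by metis
  note ev = eventually_cball_subset_ball[OF assms(2,3) r(1)]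
  have H: "(\<lambda>k. V k \<bullet> H (Y k) (V k)) \<longlonglongrightarrow> v \<bullet> H x v"
    if Y: "\<forall>\<^sub>F k in sequentially. dist (Y k) (X k) \<le> \<epsilon> k" for Y
  proof -
    have Yx: "Y \<longlonglongrightarrow> x"
      by (rule tendsto_perturb[OF assms(2,3) Y])
    \<comment> \<open>Continuity of \<open>H\<close> is known for each fixed vector only. Expanding
      in the basis turns it into convergence when base point and vector vary together.\<close>
    have rep: "H y w = (\<Sum>i\<in>Basis. (w \<bullet> i) *\<^sub>R H y i)" if "y \<in> ball x r" for y w
    proof -
      interpret linear "H y"
        using r(3)[OF that] by (rule has_derivative_linear)
      have "H y w = H y (\<Sum>i\<in>Basis. (w \<bullet> i) *\<^sub>R i)"
        by (simp add: euclidean_representation)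
      then show ?thesis
        by (simp add: sum scale)
    qed
    have "(\<lambda>k. H (Y k) i) \<longlonglongrightarrow> H x i" for i
      using assms(1) Yx by (auto simp: C2_near_def intro: isCont_tendsto_compose)
    then have "(\<lambda>k. V k \<bullet> (\<Sum>i\<in>Basis. (V k \<bullet> i) *\<^sub>R H (Y k) i)) \<longlonglongrightarrow> v \<bullet> (\<Sum>i\<in>Basis. (v \<bullet> i) *\<^sub>R H x i)"
      by (intro tendsto_intros assms(6))
    moreover have "\<forall>\<^sub>F k in sequentially. Y k \<in> ball x r"
      using tendstoD[OF Yx r(1)] by (simp add: dist_commute)
    then have "\<forall>\<^sub>F k in sequentially. V k \<bullet> (\<Sum>i\<in>Basis. (V k \<bullet> i) *\<^sub>R H (Y k) i) = V k \<bullet> H (Y k) (V k)"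
      by eventually_elim (metis rep)
    ultimately show ?thesis
      using rep[of x v] r(1) by (auto intro: Lim_transform_eventually)
  qed
  have "(\<lambda>k. (V k \<bullet> H (\<xi> k) (V k) + V k \<bullet> H (\<eta> k) (V k)) / 2) \<longlonglongrightarrow> (v \<bullet> H x v + v \<bullet> H x v) / 2"
    by (intro tendsto_intros H) (use ev \<xi> in \<open>auto elim: eventually_mono\<close>)
  moreover have "\<forall>\<^sub>F k in sequentially. (V k \<bullet> H (\<xi> k) (V k) + V k \<bullet> H (\<eta> k) (V k)) / 2 =
    (\<phi> (X k + \<epsilon> k *\<^sub>R V k) + \<phi> (X k - \<epsilon> k *\<^sub>R V k) - 2 * \<phi> (X k)) / (\<epsilon> k)\<^sup>2"
    using ev
  proof eventually_elim
    case (elim k)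
    then show ?case
      using \<xi>[OF elim] assms(4)[of k] by simp
  qed
  ultimately show ?thesis
    by (auto intro: Lim_transform_eventually)
qed

section \<open>Maximum points on shrinking balls\<close>

text \<open>Compactness gives a maximum point once \<open>\<phi>\<close> is continuous on the ball.
  It is recorded by its rescaled direction, the form in which the difference quotients take
  it.\<close>

lemma ball_maximizer:
  assumes "C2_near x \<phi> g H" "X \<longlonglongrightarrow> x" "\<epsilon> \<longlonglongrightarrow> 0" "\<And>k. \<epsilon> k > 0"
  shows "\<exists>V. (\<forall>k. norm (V k) \<le> 1) \<and>
    (\<forall>\<^sub>F k in sequentially. \<forall>y\<in>cball (X k) (\<epsilon> k). \<phi> y \<le> \<phi> (X k + \<epsilon> k *\<^sub>R V k))"
proof -
  obtain r where r: "r > 0" "\<And>y. y \<in> ball x r \<Longrightarrow> GDERIV \<phi> y :> g y"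
    using C2_near_ball[OF assms(1)] by metis
  have "\<exists>v. norm v \<le> 1 \<and> (cball (X k) (\<epsilon> k) \<subseteq> ball x r \<longrightarrow>
          (\<forall>y\<in>cball (X k) (\<epsilon> k). \<phi> y \<le> \<phi> (X k + \<epsilon> k *\<^sub>R v)))" for k
  proof (cases "cball (X k) (\<epsilon> k) \<subseteq> ball x r")
    case True
    have "continuous_on (cball (X k) (\<epsilon> k)) \<phi>"
      using r(2) True unfolding gderiv_def
      by (intro continuous_at_imp_continuous_on ballI has_derivative_continuous) blast
    then obtain p where p: "p \<in> cball (X k) (\<epsilon> k)" "\<forall>y\<in>cball (X k) (\<epsilon> k). \<phi> y \<le> \<phi> p"
      using continuous_attains_sup[of "cball (X k) (\<epsilon> k)" \<phi>] assms(4)[of k] by auto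
    have "norm ((p - X k) /\<^sub>R \<epsilon> k) \<le> 1"
      using p(1) assms(4)[of k]
      by (simp only: norm_scaleR mem_cball dist_norm norm_minus_commute) (simp add: field_simps)
    moreover have "X k + \<epsilon> k *\<^sub>R ((p - X k) /\<^sub>R \<epsilon> k) = p"
      using assms(4)[of k] by simp
    ultimately show ?thesis
      using p(2) by metis
  qed (auto intro: exI[of _ 0])
  then obtain V where V: "\<And>k. norm (V k) \<le> 1" "\<And>k. cball (X k) (\<epsilon> k) \<subseteq> ball x r \<Longrightarrow>
          \<forall>y\<in>cball (X k) (\<epsilon> k). \<phi> y \<le> \<phi> (X k + \<epsilon> k *\<^sub>R V k)"
    by metis
  show ?thesis
    by (intro exI[of _ V] conjI allI V(1)
      eventually_mono[OF eventually_cball_subset_ball[OF assms(2,3) r(1)] V(2)])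
qed

text \<open>To first order, \<open>V k\<close> maximizes \<open>v \<bullet> g x\<close> over the
  unit ball, and the only maximizer there is \<open>sgn (g x)\<close>. The estimate
  \<open>(norm (V k - n))\<^sup>2 \<le> 2 * (1 - V k \<bullet> n)\<close> makes this
  quantitative.\<close>

lemma maximizer_direction_tendsto:
  assumes "C2_near x \<phi> g H" "X \<longlonglongrightarrow> x" "\<epsilon> \<longlonglongrightarrow> 0" "\<And>k. \<epsilon> k > 0" "\<And>k. norm (V k) \<le> 1"
    and max: "\<forall>\<^sub>F k in sequentially. \<forall>y\<in>cball (X k) (\<epsilon> k). \<phi> y \<le> \<phi> (X k + \<epsilon> k *\<^sub>R V k)"
    and "g x \<noteq> 0"
  shows "V \<longlonglongrightarrow> sgn (g x)"
proof -
  define n where "n = sgn (g x)"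
  have n: "norm n = 1" "n \<bullet> g x = norm (g x)"
    using assms(7) by (auto simp: n_def norm_sgn sgn_div_norm dot_square_norm power2_eq_square)
  \<comment> \<open>The difference of two first-order errors, in the directions \<open>n\<close> and
    \<open>V k\<close>. Maximality of \<open>V k\<close> bounds it above by
    \<open>V k \<bullet> g x - norm (g x)\<close>, which is at most 0.\<close>
  define a where "a k = ((\<phi> (X k + \<epsilon> k *\<^sub>R n) - \<phi> (X k)) / \<epsilon> k - n \<bullet> g x)
    - ((\<phi> (X k + \<epsilon> k *\<^sub>R V k) - \<phi> (X k)) / \<epsilon> k - V k \<bullet> g x)" for k
  have "a \<longlonglongrightarrow> 0 - 0"
    unfolding a_def using n(1)
    by (intro tendsto_diff first_difference_tendsto[OF assms(1-4)] assms(5)) auto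
  then have lim: "(\<lambda>k. sqrt (- 2 * a k / norm (g x))) \<longlonglongrightarrow> sqrt (- 2 * 0 / norm (g x))"
    by (intro tendsto_intros) (use assms(7) in auto)
  have "\<forall>\<^sub>F k in sequentially. norm (V k - n) \<le> sqrt (- 2 * a k / norm (g x))"
    using max
  proof eventually_elim
    case (elim k)
    have "X k + \<epsilon> k *\<^sub>R n \<in> cball (X k) (\<epsilon> k)"
      using n(1) assms(4)[of k] by (simp add: dist_norm)
    then have "\<phi> (X k + \<epsilon> k *\<^sub>R n) - \<phi> (X k) \<le> \<phi> (X k + \<epsilon> k *\<^sub>R V k) - \<phi> (X k)"
      using elim by auto
    then have "(\<phi> (X k + \<epsilon> k *\<^sub>R n) - \<phi> (X k)) / \<epsilon> k \<le> (\<phi> (X k + \<epsilon> k *\<^sub>R V k) - \<phi> (X k)) / \<epsilon> k"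
      using assms(4)[of k] by (simp add: divide_right_mono)
    then have "a k \<le> V k \<bullet> g x - norm (g x)"
      using n(2) by (simp add: a_def)
    also have "g x = norm (g x) *\<^sub>R n"
      using assms(7) by (simp add: n_def sgn_div_norm)
    finally have "a k \<le> norm (g x) * (V k \<bullet> n - 1)"
      using n(1) by (simp add: algebra_simps)
    then have "1 - V k \<bullet> n \<le> - a k / norm (g x)"
      using assms(7) by (simp add: field_simps)
    moreover have "(norm (V k - n))\<^sup>2 = (norm (V k))\<^sup>2 - 2 * (V k \<bullet> n) + 1"
      using n(1) by (simp add: power2_norm_eq_inner inner_diff inner_commute norm_eq_1)
    moreover have "(norm (V k))\<^sup>2 \<le> 1"
      using assms(5)[of k] by (simp add: power_le_one)
    ultimately show ?case
      by (intro real_le_rsqrt) auto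
  qed
  then have "(\<lambda>k. V k - n) \<longlonglongrightarrow> 0"
    by (rule Lim_null_comparison) (use lim in simp)
  then show ?thesis
    unfolding n_def by (rule LIM_zero_cancel)
qed

section \<open>Approximate maxima\<close>

text \<open>The supremum of \<open>W k\<close> is controlled by \<open>\<phi>\<close> at its maximum
  point, the infimum by \<open>\<phi>\<close> at the antipode. Hence the second difference of
  \<open>\<phi>\<close> is at least \<open>- 2 * (\<epsilon> k) ^ 3\<close>, and division by
  \<open>(\<epsilon> k)\<^sup>2\<close> still leaves an error tending to 0.\<close>

lemma near_maximum_second_order:
  assumes "C2_near x \<phi> g H" "X \<longlonglongrightarrow> x" "\<epsilon> \<longlonglongrightarrow> 0" "\<And>k. \<epsilon> k > 0" "g x \<noteq> 0"
    and near: "\<forall>\<^sub>F k in sequentially. \<forall>y\<in>cball (X k) (\<epsilon> k).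
           W k y - W k (X k) \<le> \<phi> y - \<phi> (X k) + (\<epsilon> k) ^ 3"
    and mean: "\<forall>\<^sub>F k in sequentially. bdd_below (W k ` cball (X k) (\<epsilon> k)) \<and>
           2 * W k (X k) \<le> (SUP y\<in>cball (X k) (\<epsilon> k). W k y) + (INF y\<in>cball (X k) (\<epsilon> k). W k y)"
  shows "0 \<le> sgn (g x) \<bullet> H x (sgn (g x))"
proof -
  obtain V where V: "\<And>k. norm (V k) \<le> 1"
    "\<forall>\<^sub>F k in sequentially. \<forall>y\<in>cball (X k) (\<epsilon> k). \<phi> y \<le> \<phi> (X k + \<epsilon> k *\<^sub>R V k)"
    using ball_maximizer[OF assms(1-4)] by blast
  have Vn: "V \<longlonglongrightarrow> sgn (g x)"
    by (rule maximizer_direction_tendsto[OF assms(1-4) V assms(5)])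
  define q where "q k = (\<phi> (X k + \<epsilon> k *\<^sub>R V k) + \<phi> (X k - \<epsilon> k *\<^sub>R V k) - 2 * \<phi> (X k)) / (\<epsilon> k)\<^sup>2" for k
  have "q \<longlonglongrightarrow> sgn (g x) \<bullet> H x (sgn (g x))"
    unfolding q_def by (rule second_difference_tendsto[OF assms(1-4) V(1) Vn])
  moreover have "(\<lambda>k. - 2 * \<epsilon> k) \<longlonglongrightarrow> - 2 * 0"
    by (intro tendsto_intros assms(3))
  moreover have "\<forall>\<^sub>F k in sequentially. - 2 * \<epsilon> k \<le> q k"
    using V(2) near mean
  proof eventually_elim
    case (elim k)
    have e: "\<epsilon> k > 0" by (rule assms(4))
    let ?B = "cball (X k) (\<epsilon> k)"
    have "(SUP y\<in>?B. W k y) \<le> W k (X k) + \<phi> (X k + \<epsilon> k *\<^sub>R V k) - \<phi> (X k) + (\<epsilon> k) ^ 3"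
    proof (rule cSUP_least)
      show "?B \<noteq> {}" using e by simp
      show "W k y \<le> W k (X k) + \<phi> (X k + \<epsilon> k *\<^sub>R V k) - \<phi> (X k) + (\<epsilon> k) ^ 3" if "y \<in> ?B" for y
        using bspec[OF elim(1) that] bspec[OF elim(2) that] by linarith
    qed
    \<comment> \<open>The antipode is just a competitor for the infimum, not a minimum point; it is
      taken because it cancels the first-order terms.\<close>
    moreover have m: "X k - \<epsilon> k *\<^sub>R V k \<in> ?B"
      using V(1)[of k] e by (simp add: dist_norm mult_left_le)
    then have "(INF y\<in>?B. W k y) \<le> W k (X k - \<epsilon> k *\<^sub>R V k)"
      using elim(3) by (intro cINF_lower) auto
    then have "(INF y\<in>?B. W k y) \<le> W k (X k) + \<phi> (X k - \<epsilon> k *\<^sub>R V k) - \<phi> (X k) + (\<epsilon> k) ^ 3"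
      using bspec[OF elim(2) m] by linarith
    ultimately have "- 2 * (\<epsilon> k) ^ 3 \<le> \<phi> (X k + \<epsilon> k *\<^sub>R V k) + \<phi> (X k - \<epsilon> k *\<^sub>R V k) - 2 * \<phi> (X k)"
      using elim(3) by linarith
    then show ?case
      using e by (simp add: q_def pos_le_divide_eq power2_eq_square power3_eq_cube algebra_simps)
  qed
  ultimately show ?thesis
    using tendsto_le[of sequentially q _ "\<lambda>k. - 2 * \<epsilon> k" "- 2 * 0"] by simp
qed

text \<open>An increase of \<open>W k\<close> by \<open>\<epsilon> k\<close> within the ball forces
  \<open>\<phi>\<close> to increase by at least \<open>\<epsilon> k - (\<epsilon> k) ^ 3\<close>,
  whereas its increase per unit of \<open>\<epsilon> k\<close> is at most \<open>norm (g x)\<close>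
  up to a vanishing error.\<close>

lemma near_maximum_gradient_ge:
  assumes "C2_near x \<phi> g H" "X \<longlonglongrightarrow> x" "\<epsilon> \<longlonglongrightarrow> 0" "\<And>k. \<epsilon> k > 0"
    and near: "\<forall>\<^sub>F k in sequentially. \<forall>y\<in>cball (X k) (\<epsilon> k).
           W k y - W k (X k) \<le> \<phi> y - \<phi> (X k) + (\<epsilon> k) ^ 3"
    and steep: "\<forall>\<^sub>F k in sequentially. W k (X k) + \<epsilon> k \<le> (SUP y\<in>cball (X k) (\<epsilon> k). W k y)"
  shows "1 \<le> norm (g x)"
proof -
  obtain V where V: "\<And>k. norm (V k) \<le> 1"
    "\<forall>\<^sub>F k in sequentially. \<forall>y\<in>cball (X k) (\<epsilon> k). \<phi> y \<le> \<phi> (X k + \<epsilon> k *\<^sub>R V k)"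
    using ball_maximizer[OF assms(1-4)] by blast
  define a where "a k = (\<phi> (X k + \<epsilon> k *\<^sub>R V k) - \<phi> (X k)) / \<epsilon> k - V k \<bullet> g x" for k
  have "a \<longlonglongrightarrow> 0"
    unfolding a_def by (rule first_difference_tendsto[OF assms(1-4) V(1)])
  then have lim: "(\<lambda>k. 1 - (\<epsilon> k)\<^sup>2 - a k) \<longlonglongrightarrow> 1 - 0\<^sup>2 - 0"
    by (intro tendsto_intros assms(3))
  have "\<forall>\<^sub>F k in sequentially. 1 - (\<epsilon> k)\<^sup>2 - a k \<le> norm (g x)"
    using V(2) near steep
  proof eventually_elim
    case (elim k)
    have e: "\<epsilon> k > 0" by (rule assms(4))
    let ?B = "cball (X k) (\<epsilon> k)"
    have "(SUP y\<in>?B. W k y) \<le> W k (X k) + \<phi> (X k + \<epsilon> k *\<^sub>R V k) - \<phi> (X k) + (\<epsilon> k) ^ 3"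
    proof (rule cSUP_least)
      show "?B \<noteq> {}" using e by simp
      show "W k y \<le> W k (X k) + \<phi> (X k + \<epsilon> k *\<^sub>R V k) - \<phi> (X k) + (\<epsilon> k) ^ 3" if "y \<in> ?B" for y
        using bspec[OF elim(1) that] bspec[OF elim(2) that] by linarith
    qed
    then have "\<epsilon> k - (\<epsilon> k) ^ 3 \<le> \<phi> (X k + \<epsilon> k *\<^sub>R V k) - \<phi> (X k)"
      using elim(3) by linarith
    then have "1 - (\<epsilon> k)\<^sup>2 \<le> (\<phi> (X k + \<epsilon> k *\<^sub>R V k) - \<phi> (X k)) / \<epsilon> k"
      by (simp only: pos_le_divide_eq[OF e]) (simp add: power2_eq_square power3_eq_cube algebra_simps)
    moreover have "V k \<bullet> g x \<le> 1 * norm (g x)"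
      using norm_cauchy_schwarz[of "V k" "g x"] mult_right_mono[OF V(1)[of k] norm_ge_zero[of "g x"]]
      by linarith
    ultimately show ?case
      by (simp add: a_def)
  qed
  then show ?thesis
    using tendsto_upperbound[OF lim] by simp
qed

text \<open>A step of length \<open>\<epsilon> k\<close> against the gradient lowers
  \<open>\<phi>\<close> by about \<open>norm (g x) * \<epsilon> k\<close>; the excess of the slope
  over 1 absorbs the error terms. For the subsolution property this excludes that the first entry of
  the minimum vanishes.\<close>

lemma near_maximum_steep_descent:
  assumes "C2_near x \<phi> g H" "X \<longlonglongrightarrow> x" "\<epsilon> \<longlonglongrightarrow> 0" "\<And>k. \<epsilon> k > 0"
    and near: "\<forall>\<^sub>F k in sequentially. \<forall>y\<in>cball (X k) (\<epsilon> k).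
           W k y - W k (X k) \<le> \<phi> y - \<phi> (X k) + (\<epsilon> k) ^ 3"
    and "1 < norm (g x)"
  shows "\<forall>\<^sub>F k in sequentially. \<exists>y\<in>cball (X k) (\<epsilon> k). W k y + \<epsilon> k < W k (X k)"
proof -
  have "g x \<noteq> 0"
    using assms(6) by auto
  define n where "n = - sgn (g x)"
  have n: "norm n = 1" "n \<bullet> g x = - norm (g x)"
    using \<open>g x \<noteq> 0\<close> by (auto simp: n_def norm_sgn sgn_div_norm dot_square_norm power2_eq_square)
  define a where "a k = (\<phi> (X k + \<epsilon> k *\<^sub>R n) - \<phi> (X k)) / \<epsilon> k - n \<bullet> g x" for k
  have "a \<longlonglongrightarrow> 0"
    unfolding a_def by (rule first_difference_tendsto[OF assms(1-4)]) (use n in simp)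
  then have lim: "(\<lambda>k. a k + (\<epsilon> k)\<^sup>2) \<longlonglongrightarrow> 0 + 0\<^sup>2"
    by (intro tendsto_intros assms(3))
  have "\<forall>\<^sub>F k in sequentially. a k + (\<epsilon> k)\<^sup>2 < norm (g x) - 1"
    using order_tendstoD(2)[OF lim] assms(6) by simp
  with near show ?thesis
  proof eventually_elim
    case (elim k)
    have e: "\<epsilon> k > 0" by (rule assms(4))
    have m: "X k + \<epsilon> k *\<^sub>R n \<in> cball (X k) (\<epsilon> k)"
      using n(1) e by (simp add: dist_norm)
    have "(\<phi> (X k + \<epsilon> k *\<^sub>R n) - \<phi> (X k)) / \<epsilon> k < - 1 - (\<epsilon> k)\<^sup>2"
      using elim(2) n(2) by (simp add: a_def)
    then have "\<phi> (X k + \<epsilon> k *\<^sub>R n) - \<phi> (X k) < - \<epsilon> k - (\<epsilon> k) ^ 3"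
      by (simp only: pos_divide_less_eq[OF e]) (simp add: power2_eq_square power3_eq_cube algebra_simps)
    then show ?case
      using bspec[OF elim(1) m] by (intro bexI[OF _ m]) linarith
  qed
qed

text \<open>\<open>W k\<close> may be discontinuous, so maxima of \<open>W k - \<phi>\<close> are
  taken only up to \<open>\<delta> k\<close>. If \<open>W k\<close> is within \<open>\<eta>\<close>
  of \<open>w\<close>, then \<open>W k - \<phi>\<close> exceeds \<open>- \<eta>\<close> at
  \<open>x\<close> and is below \<open>\<eta> - (norm (X k - x)) ^ 4\<close> at \<open>X k\<close>;
  comparing the two drives \<open>X k\<close> to \<open>x\<close>.\<close>

lemma near_maximum_sequence:
  fixes x :: "'a::euclidean_space" and \<delta> :: "nat \<Rightarrow> real"
  assumes lim: "uniform_limit (cball x r) W w sequentially" and "0 < r"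
    and below: "\<And>y. y \<in> cball x r \<Longrightarrow> w y \<le> \<psi> y" and "w x = \<psi> x"
    and \<delta>: "\<And>k. \<delta> k > 0" "\<delta> \<longlonglongrightarrow> 0"
  defines "\<phi> \<equiv> \<lambda>y. \<psi> y + (norm (y - x)) ^ 4"
  obtains X where "X \<longlonglongrightarrow> x"
    "\<forall>\<^sub>F k in sequentially. \<forall>y\<in>cball x r. W k y - W k (X k) \<le> \<phi> y - \<phi> (X k) + \<delta> k"
proof -
  \<comment> \<open>\<open>W k - \<phi>\<close> is known to be bounded above only for large
    \<open>k\<close>, hence the premise inside the choice.\<close>
  have "\<exists>p. (\<exists>C. \<forall>y\<in>cball x r. W k y - \<phi> y \<le> C) \<longrightarrow>
          p \<in> cball x r \<and> (\<forall>y\<in>cball x r. W k y - \<phi> y \<le> W k p - \<phi> p + \<delta> k)" for k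
  proof (cases "\<exists>C. \<forall>y\<in>cball x r. W k y - \<phi> y \<le> C")
    case True
    then have bdd: "bdd_above ((\<lambda>y. W k y - \<phi> y) ` cball x r)"
      by (auto simp: bdd_above_def)
    have "cball x r \<noteq> {}"
      using assms(2) by simp
    then obtain p where "p \<in> cball x r" "(SUP y\<in>cball x r. W k y - \<phi> y) - \<delta> k < W k p - \<phi> p"
      using less_cSUP_iff[OF _ bdd, of "(SUP y\<in>cball x r. W k y - \<phi> y) - \<delta> k"] \<delta>(1)[of k] by auto
    moreover have "W k y - \<phi> y \<le> (SUP y\<in>cball x r. W k y - \<phi> y)" if "y \<in> cball x r" for y
      using that bdd by (intro cSUP_upper) auto
    ultimately show ?thesis
      by (intro exI[of _ p]) (auto simp: algebra_simps, smt (verit))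
  qed auto
  then obtain X where X: "\<And>k. \<exists>C. \<forall>y\<in>cball x r. W k y - \<phi> y \<le> C \<Longrightarrow>
      X k \<in> cball x r \<and> (\<forall>y\<in>cball x r. W k y - \<phi> y \<le> W k (X k) - \<phi> (X k) + \<delta> k)"
    by metis
  have close: "\<forall>\<^sub>F k in sequentially. X k \<in> cball x r \<and> (norm (X k - x)) ^ 4 \<le> 2 * \<eta> + \<delta> k \<and>
      (\<forall>y\<in>cball x r. W k y - \<phi> y \<le> W k (X k) - \<phi> (X k) + \<delta> k)" if "\<eta> > 0" for \<eta>
    using uniform_limitD[OF lim that]
  proof eventually_elim
    case (elim k)
    have "W k y - \<phi> y \<le> \<eta>" if "y \<in> cball x r" for y
      using bspec[OF elim that] below[OF that] zero_le_power[OF norm_ge_zero, of "y - x" 4]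
      unfolding \<phi>_def dist_real_def by linarith
    then have *: "X k \<in> cball x r" "\<forall>y\<in>cball x r. W k y - \<phi> y \<le> W k (X k) - \<phi> (X k) + \<delta> k"
      using X by metis+
    have "W k x - \<phi> x \<le> W k (X k) - \<phi> (X k) + \<delta> k" "\<bar>W k x - w x\<bar> < \<eta>" "\<bar>W k (X k) - w (X k)\<bar> < \<eta>"
      "w (X k) \<le> \<psi> (X k)"
      using * elim below assms(2) by (auto simp: dist_real_def)
    then have "(norm (X k - x)) ^ 4 \<le> 2 * \<eta> + \<delta> k"
      using assms(4) by (simp add: \<phi>_def)
    with * show ?case by blast
  qed
  have "(\<lambda>k. (norm (X k - x)) ^ 4) \<longlonglongrightarrow> 0"
  proof (rule tendstoI)
    fix e :: real assume "e > 0"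
    then have e4: "e / 4 > 0"
      by simp
    from \<open>e > 0\<close> have "\<forall>\<^sub>F k in sequentially. \<delta> k < e / 2"
      using order_tendstoD(2)[OF \<delta>(2), of "e / 2"] by simp
    then show "\<forall>\<^sub>F k in sequentially. dist ((norm (X k - x)) ^ 4) 0 < e"
      using close[OF e4] by eventually_elim auto
  qed
  then have "(\<lambda>k. root 4 ((norm (X k - x)) ^ 4)) \<longlonglongrightarrow> root 4 0"
    by (rule tendsto_real_root)
  then have "(\<lambda>k. norm (X k - x)) \<longlonglongrightarrow> 0"
    by (simp add: real_root_power_cancel)
  then have "X \<longlonglongrightarrow> x"
    using LIM_zero_cancel tendsto_norm_zero_iff by blast
  moreover have "\<forall>\<^sub>F k in sequentially. \<forall>y\<in>cball x r. W k y - W k (X k) \<le> \<phi> y - \<phi> (X k) + \<delta> k"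
    using close[OF zero_less_one] by eventually_elim (simp add: algebra_simps)
  ultimately show ?thesis
    by (rule that)
qed

section \<open>Superharmonious functions\<close>

text \<open>An increment \<open>d = v z - v y\<close> forces the infimum near \<open>y\<close> down
  to \<open>v y - d\<close> or lower. From a point \<open>p\<close> almost attaining it,
  \<open>y\<close> is a neighbour with increment about \<open>d\<close>, so the argument repeats.
  After \<open>k\<close> rounds \<open>v\<close> has dropped by about \<open>k * d\<close>, yet it
  stays above \<open>- M\<close>.\<close>

lemma superharmonious_increment_bound:
  fixes v :: "'a::euclidean_space \<Rightarrow> real"
  assumes bound: "\<And>y. y \<in> cball x R \<Longrightarrow> \<bar>v y\<bar> \<le> M" and "\<epsilon> > 0"
    and mean: "\<And>y. cball y \<epsilon> \<subseteq> cball x R \<Longrightarrow>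
      (SUP z\<in>cball y \<epsilon>. v z) + (INF z\<in>cball y \<epsilon>. v z) \<le> 2 * v y"
    and "z \<in> cball y \<epsilon>" "cball y (real k * \<epsilon>) \<subseteq> cball x R" "y \<in> cball x R"
  shows "real k * (v z - v y) \<le> v y + M"
  using assms(4-)
proof (induction k arbitrary: y z)
  case 0
  then show ?case
    using bound[of y] by simp
next
  case (Suc k)
  have sub: "cball p (real k * \<epsilon>) \<subseteq> cball x R" if "p \<in> cball y \<epsilon>" for p
  proof -
    have "cball p (real k * \<epsilon>) \<subseteq> cball y (real (Suc k) * \<epsilon>)"
      using that by (auto simp: cball_subset_cball_iff dist_commute algebra_simps)
    then show ?thesis
      using Suc.prems(2) by blast
  qed
  have "\<epsilon> \<le> real (Suc k) * \<epsilon>"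
    using assms(2) by simp
  then have B: "cball y \<epsilon> \<subseteq> cball x R"
    using Suc.prems(2) by (meson order_trans subset_cball)
  have "bdd_above (v ` cball y \<epsilon>)"
    unfolding bdd_above_def using bound B by (intro exI[of _ M]) fastforce
  then have "v z \<le> (SUP z\<in>cball y \<epsilon>. v z)"
    using Suc.prems(1) by (intro cSUP_upper)
  then have inf: "(INF p\<in>cball y \<epsilon>. v p) \<le> 2 * v y - v z"
    using mean[OF B] by linarith
  \<comment> \<open>The induction hypothesis with base point \<open>p\<close> and neighbour
    \<open>y\<close>, solved for \<open>v p\<close>. As a bound for every \<open>p\<close> it passes
    to the infimum, which may not be attained.\<close>
  have "(real k * v y - M) / (real k + 1) \<le> (INF p\<in>cball y \<epsilon>. v p)"
  proof (rule cINF_greatest)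
    show "cball y \<epsilon> \<noteq> {}"
      using assms(2) by simp
    fix p assume p: "p \<in> cball y \<epsilon>"
    have "real k * (v y - v p) \<le> v p + M"
      using p sub[OF p] subsetD[OF B p] by (intro Suc.IH) (simp_all add: dist_commute)
    then show "(real k * v y - M) / (real k + 1) \<le> v p"
      by (simp add: divide_le_eq algebra_simps)
  qed
  with inf have "(real k * v y - M) / (real k + 1) \<le> 2 * v y - v z"
    by linarith
  then have "real k * v y - M \<le> (2 * v y - v z) * (real k + 1)"
    by (simp add: divide_le_eq)
  then show ?case
    by (simp add: algebra_simps)
qed

text \<open>From a point of the half ball there is room for about
  \<open>R / (2 * \<epsilon>)\<close> steps, and the total drop is at most \<open>2 * M\<close>.
  Exchanging the two points gives the absolute value.\<close>

lemma superharmonious_step_bound: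
  fixes v :: "'a::euclidean_space \<Rightarrow> real"
  assumes bound: "\<And>y. y \<in> cball x R \<Longrightarrow> \<bar>v y\<bar> \<le> M" and \<epsilon>: "0 < \<epsilon>" "\<epsilon> \<le> R / 4"
    and mean: "\<And>y. cball y \<epsilon> \<subseteq> cball x R \<Longrightarrow>
      (SUP z\<in>cball y \<epsilon>. v z) + (INF z\<in>cball y \<epsilon>. v z) \<le> 2 * v y"
    and y: "y \<in> cball x (R / 2)" and z: "z \<in> cball x (R / 2)" and "dist y z \<le> \<epsilon>"
  shows "\<bar>v z - v y\<bar> \<le> 8 * M / R * \<epsilon>"
proof -
  have R: "R > 0"
    using \<epsilon> by simp
  \<comment> \<open>The largest number of steps covering a distance of at most \<open>R / 2\<close>.
    Rounding loses less than \<open>\<epsilon> \<le> R / 4\<close>, so at least \<open>R / 4\<close>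
    is covered; this produces the constant 8.\<close>
  define k where "k = nat \<lfloor>R / (2 * \<epsilon>)\<rfloor>"
  have "real k \<le> R / (2 * \<epsilon>)" "R / (2 * \<epsilon>) < real k + 1"
    unfolding k_def using R \<epsilon>(1) by (simp_all add: of_nat_nat)
  then have k: "real k * \<epsilon> \<le> R / 2" "R / 4 \<le> real k * \<epsilon>"
    using \<epsilon> by (auto simp: field_simps)
  have "v b - v a \<le> 8 * M / R * \<epsilon>"
    if a: "a \<in> cball x (R / 2)" and b: "b \<in> cball a \<epsilon>" for a b
  proof -
    have "cball a (real k * \<epsilon>) \<subseteq> cball x R"
      using k(1) a by (auto simp: cball_subset_cball_iff dist_commute)
    moreover have aR: "a \<in> cball x R"
      using a R by simp
    ultimately have *: "real k * (v b - v a) \<le> 2 * M"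
      using superharmonious_increment_bound[OF bound \<epsilon>(1) mean b] bound[OF aR] by fastforce
    show ?thesis
    proof (cases "v a \<le> v b")
      case True
      then have "R / 4 * (v b - v a) \<le> real k * \<epsilon> * (v b - v a)"
        using k(2) by (intro mult_right_mono) auto
      also have "\<dots> \<le> 2 * M * \<epsilon>"
        using mult_right_mono[OF *, of \<epsilon>] \<epsilon>(1) by (simp add: mult_ac)
      finally show ?thesis
        using R by (simp add: field_simps)
    next
      case False
      have "0 \<le> 8 * M / R * \<epsilon>"
        using bound[OF aR] \<epsilon>(1) R by (intro mult_nonneg_nonneg divide_nonneg_nonneg) auto
      with False show ?thesis by linarith
    qed
  qed
  from this[OF y, of z] this[OF z, of y] assms(7) show ?thesis
    by (auto simp: dist_commute)
qed

text \<open>The segment from \<open>y\<close> to \<open>z\<close> is cut into pieces no longer than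
  \<open>\<epsilon>\<close>. Rounding up their number costs at most one piece, which is the extra
  \<open>\<epsilon>\<close>.\<close>

lemma convex_chain_bound:
  fixes v :: "'a::euclidean_space \<Rightarrow> real"
  assumes "convex S" "0 < \<epsilon>"
    and step: "\<And>y z. y \<in> S \<Longrightarrow> z \<in> S \<Longrightarrow> dist y z \<le> \<epsilon> \<Longrightarrow> \<bar>v z - v y\<bar> \<le> L * \<epsilon>"
    and y: "y \<in> S" and "z \<in> S"
  shows "\<bar>v z - v y\<bar> \<le> L * (dist y z + \<epsilon>)"
proof -
  have chain: "\<bar>v z - v y\<bar> \<le> real n * (L * \<epsilon>)" if "z \<in> S" "dist y z \<le> real n * \<epsilon>" for n z
    using that
  proof (induction n arbitrary: z)
    case 0
    then show ?case by simp
  next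
    case (Suc n)
    \<comment> \<open>The point \<open>p\<close> divides the segment in the ratio \<open>n\<close>
      to 1: the induction hypothesis reaches \<open>p\<close>, and one step remains.\<close>
    define t where "t = real n / real (Suc n)"
    have t: "0 \<le> t" "t \<le> 1"
      by (auto simp: t_def)
    define p where "p = (1 - t) *\<^sub>R y + t *\<^sub>R z"
    have "p \<in> S"
      unfolding p_def using assms(1) y Suc.prems(1) t by (auto simp: convex_alt)
    have "y - p = t *\<^sub>R (y - z)" "p - z = (1 - t) *\<^sub>R (y - z)"
      by (simp_all add: p_def algebra_simps)
    then have "dist y p = t * dist y z" "dist p z = (1 - t) * dist y z"
      using t by (simp_all add: dist_norm)
    moreover have "t * dist y z \<le> t * (real (Suc n) * \<epsilon>)" "(1 - t) * dist y z \<le> (1 - t) * (real (Suc n) * \<epsilon>)"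
      using Suc.prems(2) t by (auto intro!: mult_left_mono simp del: of_nat_Suc)
    moreover have "t * real (Suc n) = real n" "(1 - t) * real (Suc n) = 1"
      by (simp_all add: t_def field_simps)
    ultimately have "dist y p \<le> real n * \<epsilon>" "dist p z \<le> \<epsilon>"
      by (simp_all add: mult.assoc[symmetric] del: of_nat_Suc)
    then have "\<bar>v p - v y\<bar> \<le> real n * (L * \<epsilon>)" "\<bar>v z - v p\<bar> \<le> L * \<epsilon>"
      using Suc.IH \<open>p \<in> S\<close> Suc.prems(1) step by auto
    then show ?case
      by (simp add: algebra_simps)
  qed
  define n where "n = nat \<lceil>dist y z / \<epsilon>\<rceil>"
  have "dist y z / \<epsilon> \<le> real n" "real n < dist y z / \<epsilon> + 1"
    unfolding n_def using assms(2) by (simp_all add: of_nat_nat) linarith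
  then have n: "dist y z \<le> real n * \<epsilon>" "real n * \<epsilon> \<le> dist y z + \<epsilon>"
    using assms(2) by (auto simp: field_simps)
  have L: "0 \<le> L * \<epsilon>"
    using step[OF y y] assms(2) by simp
  have "\<bar>v z - v y\<bar> \<le> L * (real n * \<epsilon>)"
    using chain[OF assms(5) n(1)] by (simp add: mult_ac)
  also have "\<dots> \<le> L * (dist y z + \<epsilon>)"
    using n(2) L assms(2) by (intro mult_left_mono) (auto simp: zero_le_mult_iff)
  finally show ?thesis .
qed

text \<open>The slope \<open>8 * M / R\<close> is the same for all large \<open>k\<close>, and the
  additive \<open>\<epsilon> k\<close> of the chain bound disappears in the limit. Thus the limit is
  Lipschitz although the \<open>W k\<close> may jump.\<close>

lemma superharmonious_limit_lipschitz:
  fixes W :: "nat \<Rightarrow> 'a::euclidean_space \<Rightarrow> real"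
  assumes lim: "\<And>y. y \<in> cball x R \<Longrightarrow> (\<lambda>k. W k y) \<longlonglongrightarrow> w y"
    and "R > 0" and \<epsilon>: "\<epsilon> \<longlonglongrightarrow> 0" "\<And>k. \<epsilon> k > 0"
    and bound: "\<forall>\<^sub>F k in sequentially. \<forall>y\<in>cball x R. \<bar>W k y\<bar> \<le> M"
    and mean: "\<And>k y. cball y (\<epsilon> k) \<subseteq> cball x R \<Longrightarrow>
      (SUP z\<in>cball y (\<epsilon> k). W k z) + (INF z\<in>cball y (\<epsilon> k). W k z) \<le> 2 * W k y"
    and y: "y \<in> cball x (R / 2)" and z: "z \<in> cball x (R / 2)"
  shows "\<bar>w z - w y\<bar> \<le> 8 * M / R * dist y z"
proof -
  have "\<forall>\<^sub>F k in sequentially. \<epsilon> k < R / 4"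
    using order_tendstoD(2)[OF \<epsilon>(1), of "R / 4"] assms(2) by simp
  with bound have "\<forall>\<^sub>F k in sequentially. \<bar>W k z - W k y\<bar> \<le> 8 * M / R * (dist y z + \<epsilon> k)"
  proof eventually_elim
    case (elim k)
    show ?case
    proof (rule convex_chain_bound[OF convex_cball \<epsilon>(2) _ y z])
      fix a b assume "a \<in> cball x (R / 2)" "b \<in> cball x (R / 2)" "dist a b \<le> \<epsilon> k"
      then show "\<bar>W k b - W k a\<bar> \<le> 8 * M / R * \<epsilon> k"
        by (intro superharmonious_step_bound[OF _ \<epsilon>(2) _ mean]) (use elim in auto)
    qed
  qed
  moreover have "(\<lambda>k. 8 * M / R * (dist y z + \<epsilon> k)) \<longlonglongrightarrow> 8 * M / R * (dist y z + 0)"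
    by (intro tendsto_intros \<epsilon>)
  moreover have "(\<lambda>k. \<bar>W k z - W k y\<bar>) \<longlonglongrightarrow> \<bar>w z - w y\<bar>"
    by (intro tendsto_intros lim) (use y z assms(2) in auto)
  ultimately show ?thesis
    using tendsto_le[OF sequentially_bot] by fastforce
qed

section \<open>The limit of solutions of the dynamic programming principle\<close>

text \<open>True for bounded and unbounded families alike, since the real infimum is defined as the
  negated supremum of the negated set.\<close>

lemma INF_uminus_real: "(INF y\<in>B. - f y) = - (SUP y\<in>B. f y)" for f :: "'a \<Rightarrow> real"
  by (simp add: Inf_real_def image_image)

lemma SUP_uminus_real: "(SUP y\<in>B. - f y) = - (INF y\<in>B. f y)" for f :: "'a \<Rightarrow> real"
  by (simp add: Inf_real_def image_image)

text \<open>Away from the boundary the intersection with the closure is the full ball. That a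
  minimum of two numbers is 0 means that both are nonnegative and one of them vanishes.\<close>

lemma dpp_solution_cball:
  assumes "dpp_solution \<Omega> F \<epsilon> v" "\<epsilon> > 0" "cball x \<epsilon> \<subseteq> \<Omega>"
  shows "bdd_above (v ` cball x \<epsilon>)" "bdd_below (v ` cball x \<epsilon>)"
    and "(INF y\<in>cball x \<epsilon>. v y) + \<epsilon> \<le> v x"
    and "(SUP y\<in>cball x \<epsilon>. v y) + (INF y\<in>cball x \<epsilon>. v y) \<le> 2 * v x"
    and "(INF y\<in>cball x \<epsilon>. v y) + \<epsilon> = v x \<or>
         (SUP y\<in>cball x \<epsilon>. v y) + (INF y\<in>cball x \<epsilon>. v y) = 2 * v x"
proof -
  have "x \<in> \<Omega>"
    using assms(2,3) by auto
  moreover have "cball x \<epsilon> \<inter> closure \<Omega> = cball x \<epsilon>"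
    using assms(3) closure_subset by blast
  ultimately have "bdd_above (v ` cball x \<epsilon>) \<and> bdd_below (v ` cball x \<epsilon>) \<and>
    min (v x - (INF y\<in>cball x \<epsilon>. v y) - \<epsilon>)
           (v x - 1 / 2 * ((SUP y\<in>cball x \<epsilon>. v y) + (INF y\<in>cball x \<epsilon>. v y))) = 0"
    using dpp_operator_eq_0_iff[of x \<Omega> \<epsilon> v] assms(1,2) closure_subset[of \<Omega>]
    by (auto simp: dpp_solution_def)
  then show "bdd_above (v ` cball x \<epsilon>)" "bdd_below (v ` cball x \<epsilon>)"
    "(INF y\<in>cball x \<epsilon>. v y) + \<epsilon> \<le> v x"
    "(SUP y\<in>cball x \<epsilon>. v y) + (INF y\<in>cball x \<epsilon>. v y) \<le> 2 * v x"
    "(INF y\<in>cball x \<epsilon>. v y) + \<epsilon> = v x \<or>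
       (SUP y\<in>cball x \<epsilon>. v y) + (INF y\<in>cball x \<epsilon>. v y) = 2 * v x"
    by (auto simp: min_def field_simps split: if_splits)
qed

text \<open>Approximate maxima with tolerance \<open>(\<epsilon> k) ^ 3\<close>, restricted to the
  balls of radius \<open>\<epsilon> k\<close>. No equation for \<open>W\<close> enters, so this
  serves both the solutions and their negatives.\<close>

lemma touching_sequence:
  fixes x :: "'a::euclidean_space"
  assumes "open S" "x \<in> S" and lim: "uniform_limit S W w sequentially"
    and touch: "\<forall>\<^sub>F y in nhds x. w y \<le> \<psi> y" "w x = \<psi> x"
    and \<epsilon>: "\<epsilon> \<longlonglongrightarrow> 0" "\<And>k. \<epsilon> k > 0"
  defines "\<phi> \<equiv> \<lambda>y. \<psi> y + (norm (y - x)) ^ 4"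
  shows "\<exists>X. X \<longlonglongrightarrow> x \<and> (\<forall>\<^sub>F k in sequentially. cball (X k) (\<epsilon> k) \<subseteq> S) \<and>
    (\<forall>\<^sub>F k in sequentially. \<forall>y\<in>cball (X k) (\<epsilon> k).
       W k y - W k (X k) \<le> \<phi> y - \<phi> (X k) + (\<epsilon> k) ^ 3)"
proof -
  have "\<forall>\<^sub>F y in nhds x. w y \<le> \<psi> y \<and> y \<in> S"
    using touch(1) eventually_nhds_in_open[OF assms(1,2)] by (rule eventually_conj)
  then obtain d where d: "d > 0" "\<And>y. dist y x < d \<Longrightarrow> w y \<le> \<psi> y \<and> y \<in> S"
    unfolding eventually_nhds_metric by auto
  define r where "r = d / 2"
  have r: "r > 0" "\<And>y. y \<in> cball x r \<Longrightarrow> w y \<le> \<psi> y" "cball x r \<subseteq> S"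
    using d by (auto simp: r_def dist_commute)
  have l: "uniform_limit (cball x r) W w sequentially"
    using lim r(3) by (rule uniform_limit_on_subset)
  have p: "(\<epsilon> k) ^ 3 > 0" for k
    using \<epsilon>(2)[of k] by simp
  have p0: "(\<lambda>k. (\<epsilon> k) ^ 3) \<longlonglongrightarrow> 0"
    using tendsto_power[OF \<epsilon>(1), of 3] by simp
  show ?thesis
  proof (rule near_maximum_sequence[OF l r(1,2) touch(2) p p0, folded \<phi>_def])
    fix X
    assume X: "X \<longlonglongrightarrow> x" and near: "\<forall>\<^sub>F k in sequentially. \<forall>y\<in>cball x r.
      W k y - W k (X k) \<le> \<psi> y + norm (y - x) ^ 4 - (\<psi> (X k) + norm (X k - x) ^ 4) + (\<epsilon> k) ^ 3"
    have sub: "\<forall>\<^sub>F k in sequentially. cball (X k) (\<epsilon> k) \<subseteq> cball x r"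
      using eventually_cball_subset_ball[OF X \<epsilon>(1) r(1)]
      by (rule eventually_mono) (use ball_subset_cball in blast)
    have "\<forall>\<^sub>F k in sequentially. cball (X k) (\<epsilon> k) \<subseteq> S"
      using sub by (rule eventually_mono) (use r(3) in blast)
    moreover have "\<forall>\<^sub>F k in sequentially. \<forall>y\<in>cball (X k) (\<epsilon> k).
       W k y - W k (X k) \<le> \<phi> y - \<phi> (X k) + (\<epsilon> k) ^ 3"
      using sub near by eventually_elim (auto simp: \<phi>_def)
    ultimately show ?thesis
      using X by (intro exI[of _ X] conjI)
  qed
qed

section \<open>Test functions touching the limit from above and from below\<close>

text \<open>A slope above 1 makes \<open>U k\<close> drop by more than \<open>\<epsilon> k\<close>
  near the approximate maximum. The first entry of the minimum is then positive, so the second must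
  vanish, and this is the mean value relation that yields the second-order inequality.\<close>

lemma subsolution_test:
  fixes x :: "'a::euclidean_space"
  assumes "open \<Omega>" "x \<in> \<Omega>" and lim: "uniform_limit \<Omega> U u sequentially"
    and \<epsilon>: "\<epsilon> \<longlonglongrightarrow> 0" "\<And>k. \<epsilon> k > 0"
    and sol: "\<And>k. dpp_solution \<Omega> F (\<epsilon> k) (U k)"
    and touch: "\<forall>\<^sub>F y in nhds x. u y \<le> \<psi> y" "u x = \<psi> x"
    and C2: "C2_near x \<psi> g H" and steep: "1 < norm (g x)"
  shows "0 \<le> sgn (g x) \<bullet> H x (sgn (g x))"
proof -
  obtain X where X: "X \<longlonglongrightarrow> x" and sub: "\<forall>\<^sub>F k in sequentially. cball (X k) (\<epsilon> k) \<subseteq> \<Omega>"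
    and near: "\<forall>\<^sub>F k in sequentially. \<forall>y\<in>cball (X k) (\<epsilon> k).
       U k y - U k (X k) \<le> (\<psi> y + norm (y - x) ^ 4) - (\<psi> (X k) + norm (X k - x) ^ 4) + (\<epsilon> k) ^ 3"
    using touching_sequence[OF assms(1,2) lim touch \<epsilon>] by auto
  note C2' = C2_near_add_quartic[OF C2]
  have "\<forall>\<^sub>F k in sequentially. \<exists>y\<in>cball (X k) (\<epsilon> k). U k y + \<epsilon> k < U k (X k)"
    by (rule near_maximum_steep_descent[OF C2' X \<epsilon> near]) (use steep in simp)
  with sub have mean: "\<forall>\<^sub>F k in sequentially. bdd_below (U k ` cball (X k) (\<epsilon> k)) \<and>
    2 * U k (X k) \<le> (SUP y\<in>cball (X k) (\<epsilon> k). U k y) + (INF y\<in>cball (X k) (\<epsilon> k). U k y)"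
  proof eventually_elim
    case (elim k)
    note dpp = dpp_solution_cball[OF sol \<epsilon>(2) elim(1)]
    obtain y where y: "y \<in> cball (X k) (\<epsilon> k)" "U k y + \<epsilon> k < U k (X k)"
      using elim(2) by auto
    have "(INF y\<in>cball (X k) (\<epsilon> k). U k y) \<le> U k y"
      using y(1) dpp(2) by (intro cINF_lower)
    with dpp(2,5) y(2) show ?case
      by auto
  qed
  have "g x \<noteq> 0"
    using steep by auto
  then show ?thesis
    using near_maximum_second_order[OF C2' X \<epsilon> _ near mean] by simp
qed

text \<open>Applied to \<open>- U k\<close>, which is touched from above by \<open>- \<psi>\<close>.
  Nonnegativity of the first entry gives the slope bound, that of the second the mean value
  inequality; the slope bound also supplies \<open>g x \<noteq> 0\<close>.\<close>

lemma supersolution_test: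
  fixes x :: "'a::euclidean_space"
  assumes "open \<Omega>" "x \<in> \<Omega>" and lim: "uniform_limit \<Omega> U u sequentially"
    and \<epsilon>: "\<epsilon> \<longlonglongrightarrow> 0" "\<And>k. \<epsilon> k > 0"
    and sol: "\<And>k. dpp_solution \<Omega> F (\<epsilon> k) (U k)"
    and touch: "\<forall>\<^sub>F y in nhds x. \<psi> y \<le> u y" "u x = \<psi> x"
    and C2: "C2_near x \<psi> g H"
  shows "1 \<le> norm (g x)" "sgn (g x) \<bullet> H x (sgn (g x)) \<le> 0"
proof -
  have lim': "uniform_limit \<Omega> (\<lambda>k y. - U k y) (\<lambda>y. - u y) sequentially"
    using lim by (rule uniform_limit_uminus)
  have touch': "\<forall>\<^sub>F y in nhds x. - u y \<le> - \<psi> y" "- u x = - \<psi> x"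
    using touch by auto
  obtain X where X: "X \<longlonglongrightarrow> x" and sub: "\<forall>\<^sub>F k in sequentially. cball (X k) (\<epsilon> k) \<subseteq> \<Omega>"
    and near: "\<forall>\<^sub>F k in sequentially. \<forall>y\<in>cball (X k) (\<epsilon> k). - U k y - - U k (X k) \<le>
      (- \<psi> y + norm (y - x) ^ 4) - (- \<psi> (X k) + norm (X k - x) ^ 4) + (\<epsilon> k) ^ 3"
    using touching_sequence[OF assms(1,2) lim' touch' \<epsilon>] by auto
  note C2' = C2_near_add_quartic[OF C2_near_uminus[OF C2]]
  have "\<forall>\<^sub>F k in sequentially. - U k (X k) + \<epsilon> k \<le> (SUP y\<in>cball (X k) (\<epsilon> k). - U k y)"
    using sub
  proof eventually_elim
    case (elim k)
    then show ?case
      using dpp_solution_cball(3)[OF sol \<epsilon>(2) elim] by (simp add: SUP_uminus_real)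
  qed
  from near_maximum_gradient_ge[where W = "\<lambda>k y. - U k y", OF C2' X \<epsilon> near this] show ge: "1 \<le> norm (g x)"
    by simp
  have mean: "\<forall>\<^sub>F k in sequentially. bdd_below ((\<lambda>y. - U k y) ` cball (X k) (\<epsilon> k)) \<and>
    2 * - U k (X k) \<le> (SUP y\<in>cball (X k) (\<epsilon> k). - U k y) + (INF y\<in>cball (X k) (\<epsilon> k). - U k y)"
    using sub
  proof eventually_elim
    case (elim k)
    note dpp = dpp_solution_cball[OF sol \<epsilon>(2) elim]
    have "bdd_below ((\<lambda>y. - U k y) ` cball (X k) (\<epsilon> k))"
      using dpp(1) by (simp add: bdd_above_uminus image_image flip: bdd_below_uminus)
    then show ?case
      using dpp(4) by (simp add: SUP_uminus_real INF_uminus_real)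
  qed
  have "g x \<noteq> 0"
    using ge by auto
  then have "0 \<le> sgn (- g x) \<bullet> - H x (sgn (- g x))"
    using near_maximum_second_order[where W = "\<lambda>k y. - U k y", OF C2' X \<epsilon> _ near mean] by simp
  \<comment> \<open>Linearity makes the quadratic form even, so the reversed gradient direction does
    not matter.\<close>
  moreover have "linear (H x)"
    using C2 by (auto simp: C2_near_def dest!: eventually_nhds_x_imp_x intro: has_derivative_linear)
  ultimately show "sgn (g x) \<bullet> H x (sgn (g x)) \<le> 0"
    by (simp add: sgn_minus linear_neg)
qed

text \<open>Uniform convergence alone gives no continuity, as the \<open>U k\<close> may be
  discontinuous; the Lipschitz bound for limits does. The local bound it requires comes from one
  \<open>U m\<close> and spreads to all large \<open>k\<close> by uniform convergence.\<close>

lemma dpp_limit_isCont: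
  fixes x :: "'a::euclidean_space"
  assumes "open \<Omega>" "x \<in> \<Omega>" and lim: "uniform_limit \<Omega> U u sequentially"
    and \<epsilon>: "\<epsilon> \<longlonglongrightarrow> 0" "\<And>k. \<epsilon> k > 0"
    and sol: "\<And>k. dpp_solution \<Omega> F (\<epsilon> k) (U k)"
  shows "isCont u x"
proof -
  have ev: "\<forall>\<^sub>F k in sequentially. \<forall>y\<in>\<Omega>. dist (U k y) (u y) < 1"
    using lim by (rule uniform_limitD) simp
  obtain d where d: "d > 0" "cball x d \<subseteq> \<Omega>"
    using assms(1,2) open_contains_cball by metis
  have "\<forall>\<^sub>F k in sequentially. \<epsilon> k < d"
    using order_tendstoD(2)[OF \<epsilon>(1)] d(1) by simp
  with ev have "\<forall>\<^sub>F k in sequentially. \<epsilon> k < d \<and> (\<forall>y\<in>\<Omega>. dist (U k y) (u y) < 1)"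
    by (auto intro: eventually_conj)
  then obtain m where m: "\<epsilon> m < d" "\<forall>y\<in>\<Omega>. dist (U m y) (u y) < 1"
    unfolding eventually_sequentially by auto
  \<comment> \<open>The equation for \<open>U m\<close> at \<open>x\<close> guarantees boundedness
    exactly on the ball of radius \<open>\<epsilon> m\<close>.\<close>
  define R where "R = \<epsilon> m"
  have R: "R > 0" "cball x R \<subseteq> \<Omega>"
    using \<epsilon>(2) m(1) d(2) unfolding R_def by auto
  obtain a b where ab: "\<And>y. y \<in> cball x R \<Longrightarrow> U m y \<le> a" "\<And>y. y \<in> cball x R \<Longrightarrow> b \<le> U m y"
    using dpp_solution_cball(1,2)[OF sol \<epsilon>(2), of x m] R(2) unfolding R_def bdd_above_def bdd_below_def
    by (metis imageI)
  \<comment> \<open>The summand 2 pays for passing from \<open>U k\<close> to \<open>u\<close> and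
    from \<open>u\<close> to \<open>U m\<close>, each at a cost below 1.\<close>
  define M where "M = \<bar>a\<bar> + \<bar>b\<bar> + 2"
  have bound: "\<forall>\<^sub>F k in sequentially. \<forall>y\<in>cball x R. \<bar>U k y\<bar> \<le> M"
    using ev
  proof (eventually_elim, intro ballI)
    fix k y assume k: "\<forall>y\<in>\<Omega>. dist (U k y) (u y) < 1" and y: "y \<in> cball x R"
    have "\<bar>U k y - u y\<bar> < 1" "\<bar>U m y - u y\<bar> < 1"
      using k m(2) R(2) y by (auto simp: dist_real_def)
    with ab[OF y] show "\<bar>U k y\<bar> \<le> M"
      unfolding M_def by linarith
  qed
  have mean: "(SUP z\<in>cball y (\<epsilon> k). U k z) + (INF z\<in>cball y (\<epsilon> k). U k z) \<le> 2 * U k y"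
    if "cball y (\<epsilon> k) \<subseteq> cball x R" for k y
    by (rule dpp_solution_cball(4)[OF sol \<epsilon>(2) order_trans[OF that R(2)]])
  have lip: "\<bar>u z - u x\<bar> \<le> 8 * M / R * dist x z" if "z \<in> cball x (R / 2)" for z
  proof (rule superharmonious_limit_lipschitz[OF _ R(1) \<epsilon> bound mean _ that])
    show "(\<lambda>k. U k y) \<longlonglongrightarrow> u y" if "y \<in> cball x R" for y
      using tendsto_uniform_limitI[OF lim] R(2) that by blast
  qed (use R(1) in auto)
  have "\<forall>\<^sub>F z in at x. norm (u z - u x) \<le> 8 * M / R * dist x z"
    using eventually_at_ball'[OF half_gt_zero[OF R(1)], of x UNIV]
    by (rule eventually_mono) (use lip in auto)
  moreover have "((\<lambda>z. 8 * M / R * dist x z) \<longlongrightarrow> 8 * M / R * dist x x) (at x)"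
    by (intro tendsto_intros)
  ultimately have "((\<lambda>z. u z - u x) \<longlongrightarrow> 0) (at x)"
    by (auto intro: Lim_null_comparison)
  then show ?thesis
    unfolding isCont_def by (rule LIM_zero_cancel)
qed

theorem proposition4p1:
  fixes \<Omega> :: "(real ^ 'n) set"
    and F :: "real ^ 'n \<Rightarrow> real"
    and u\<^sub>\<epsilon> :: "real \<Rightarrow> real ^ 'n \<Rightarrow> real"
    and u :: "real ^ 'n \<Rightarrow> real"
  assumes "open \<Omega>" "connected \<Omega>" "\<Omega> \<noteq> {}"
    and "bounded (F ` frontier \<Omega>)"
    and "\<And>\<epsilon>. \<epsilon> > 0 \<Longrightarrow> dpp_solution \<Omega> F \<epsilon> (u\<^sub>\<epsilon> \<epsilon>)"
    and "uniform_limit (closure \<Omega>) u\<^sub>\<epsilon> u (at_right 0)"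
  shows "viscosity_solution \<Omega> u \<and> (\<forall>x\<in>frontier \<Omega>. u x = F x)"
proof -
  \<comment> \<open>The limit \<open>u\<close> does not depend on the radius, so a single sequence
    of radii tending to 0 carries the whole argument.\<close>
  define \<epsilon> where "\<epsilon> k = inverse (real (Suc k))" for k
  have \<epsilon>: "\<epsilon> \<longlonglongrightarrow> 0" "\<And>k. \<epsilon> k > 0"
    unfolding \<epsilon>_def using LIMSEQ_inverse_real_of_nat by auto
  define U where "U k = u\<^sub>\<epsilon> (\<epsilon> k)" for k
  have "filterlim \<epsilon> (at_right 0) sequentially"
    using \<epsilon> by (intro filterlim_at_withinI) auto
  then have lim: "uniform_limit (closure \<Omega>) U u sequentially"
    unfolding U_def by (rule filterlim_compose[OF assms(6)])
  then have lim\<Omega>: "uniform_limit \<Omega> U u sequentially"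
    using closure_subset by (rule uniform_limit_on_subset)
  have sol: "dpp_solution \<Omega> F (\<epsilon> k) (U k)" for k
    unfolding U_def using assms(5) \<epsilon>(2) by blast
  have cont: "isCont u x" if "x \<in> \<Omega>" for x
    by (rule dpp_limit_isCont[OF assms(1) that lim\<Omega> \<epsilon> sol])
  have tend: "(u \<longlongrightarrow> u x) (at x within \<Omega>)" if "x \<in> \<Omega>" for x
    using cont[OF that] continuous_at_imp_continuous_at_within continuous_within by blast
  have lap: "normalized_inf_laplacian \<phi> x =
      sgn (gradient \<phi> x) \<bullet> hessian \<phi> x (sgn (gradient \<phi> x))" if "gradient \<phi> x \<noteq> 0" for \<phi> x
    using that by (simp add: normalized_inf_laplacian_def sgn_div_norm inner_commute)
  have "viscosity_subsolution \<Omega> u"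
    unfolding viscosity_subsolution_def
  proof (intro conjI allI impI)
    show "upper_semicontinuous_on \<Omega> u"
      unfolding upper_semicontinuous_on_def using order_tendstoD(2)[OF tend] by blast
    fix x \<phi>
    assume x: "x \<in> \<Omega>" "C2_on \<Omega> \<phi>" "u x = \<phi> x" "\<forall>\<^sub>F y in nhds x. u y \<le> \<phi> y"
    \<comment> \<open>A slope of at most 1 settles the claim by the first entry alone; this covers a
      vanishing gradient, whatever the value of the Laplacian there.\<close>
    show "min (norm (gradient \<phi> x) - 1) (- normalized_inf_laplacian \<phi> x) \<le> 0"
    proof (cases "norm (gradient \<phi> x) \<le> 1")
      case False
      then have g: "1 < norm (gradient \<phi> x)" "gradient \<phi> x \<noteq> 0"
        by auto
      show ?thesis
        using subsolution_test[OF assms(1) x(1) lim\<Omega> \<epsilon> sol x(4,3)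
            C2_near_of_C2_on[OF assms(1) x(1,2)] g(1)] lap[OF g(2)]
        by simp
    qed simp
  qed
  moreover have "viscosity_supersolution \<Omega> u"
    unfolding viscosity_supersolution_def
  proof (intro conjI allI impI)
    show "lower_semicontinuous_on \<Omega> u"
      unfolding lower_semicontinuous_on_def using order_tendstoD(1)[OF tend] by blast
    fix x \<phi>
    assume x: "x \<in> \<Omega>" "C2_on \<Omega> \<phi>" "u x = \<phi> x" "\<forall>\<^sub>F y in nhds x. u y \<ge> \<phi> y"
    note test = supersolution_test[OF assms(1) x(1) lim\<Omega> \<epsilon> sol x(4,3)
        C2_near_of_C2_on[OF assms(1) x(1,2)]]
    then have "gradient \<phi> x \<noteq> 0"
      by auto
    with test lap[OF this] show "min (norm (gradient \<phi> x) - 1) (- normalized_inf_laplacian \<phi> x) \<ge> 0"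
      by simp
  qed
  moreover have "u x = F x" if "x \<in> frontier \<Omega>" for x
  proof -
    have "U k x = F x" for k
      using sol[of k] that by (auto simp: dpp_solution_def)
    moreover have "(\<lambda>k. U k x) \<longlonglongrightarrow> u x"
      using tendsto_uniform_limitI[OF lim] that by (auto simp: frontier_def)
    ultimately show ?thesis
      by (simp add: LIMSEQ_const_iff)
  qed
  ultimately show ?thesis
    by (simp add: viscosity_solution_def)
qed

end
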